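(* Consider the problem (P): $\min\{f(x)=g(x)-h(x): x\in\mathcal{C}\}$ described in the context, and let $\{(x^k,y^k,z^k)\}$ be an (infinite) sequence generated by the Boosted-DCA (see context) from an initial point $x^0\in\operatorname{dom}\partial h$. Let $g$ be convex over $\mathcal{C}$ with modulus $\rho_g\ge 0$ and $h$ be convex over $\mathcal{C}$ with modulus $\rho_h\ge 0$. Suppose that at least one of $g$ and $h$ is strongly convex over $\mathcal{C}$ (i.e. $\rho_g+\rho_h>0$), that the sequence $\{(x^k,y^k,z^k)\}$ is bounded, and that $f$ is bounded from below over $\mathcal{C}$. Then: (i) for every $k=1,2,\ldots$, $f(x^k)-f(y^k)\ge\frac{\rho_g+\rho_h}{2}\|x^k-y^k\|^2$; (ii) the sequence $\{f(x^k)\}_{k\ge1}$ is non-increasing and convergent; (iii) $\|x^k-y^k\|\to0$ and $\|x^k-x^{k+1}\|\to0$ as $k\to\infty$; (iv) $\sum_{k\ge0}\|y^k-x^k\|^2<\infty$ and $\sum_{k\ge0}\|x^{k+1}-x^k\|^2<\infty$; (v) any limit point of the sequence $\{x^k\}$ is a DC critical point of (P); moreover, if $h$ is continuously differentiable, then any limit point of $\{x^k\}$ is a strongly DC critical point of (P). Let $\Phi(x):=f(x)+\chi_{\mathcal{C}}(x)$ and suppose in addition that $\Phi$ verifies the Łojasiewicz subgradient inequality and that $h$ has locally Lipschitz continuous gradient over $\mathcal{C}$. Then: (vi) $\sum_{k\ge0}\|y^k-x^k\|<\infty$ and $\sum_{k\ge0}\|x^{k+1}-x^k\|<\infty$; (vii)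 the sequence $\{x^k\}$ converges to a strongly DC critical point of (P).
   Context: Problem (P): $\Gamma_0(\mathbb{R}^n)$ is the set of closed proper convex functions $\mathbb{R}^n\to(-\infty,\infty]$, with the convention $\infty-\infty=\infty$. $g,h\in\Gamma_0(\mathbb{R}^n)$; $\mathcal{C}=\{x\in\mathbb{R}^n:u(x)\le0,\ v(x)=0\}$ is a nonempty closed convex set with $u:\mathbb{R}^n\to\mathbb{R}^p$ (componentwise) convex and $v:\mathbb{R}^n\to\mathbb{R}^q$ affine. $\chi_{\mathcal{C}}$ is the indicator function of $\mathcal{C}$ ($0$ on $\mathcal{C}$, $+\infty$ elsewhere). As a DC program, (P) means $\inf (g+\chi_{\mathcal{C}})-h$, with finite optimal value, so that $\emptyset\ne\operatorname{dom}(g+\chi_{\mathcal{C}})\subset\operatorname{dom}h$. $\|\cdot\|$ is the Euclidean norm, $\partial$ the convex subdifferential, $\operatorname{dom}\partial h=\{x:\partial h(x)\neq\emptyset\}$. A function $\phi$ is convex over $\mathcal{C}$ with modulus $\rho\ge0$ if $\phi-\frac{\rho}{2}\|\cdot\|^2$ is convex over $\mathcal{C}$; strongly convex means $\rho>0$ is possible. $A(x)=\{i\in\{1,\dots,p\}:u_i(x)=0\}$ is the active set. The directional derivative is $f'(x;d)=\lim_{t\downarrow0}\frac{f(x+td)-f(x)}{t}$. Boosted-DCA. Fixed parameters: initial stepsize $\bar\alpha>0$, $\beta\in(0,1)$, $\sigma\in(0,1)$, line-search tolerance $\varepsilon>0$. For $k=0,1,2,\ldots$ (outer stopping test ignored):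 choose $z^k\in\partial h(x^k)$; choose $y^k\in\operatorname{argmin}\{g(x)-\langle x,z^k\rangle:x\in\mathcal{C}\}$; set $d^k=y^k-x^k$. If $A(y^k)\subset A(x^k)$ and $f'(y^k;d^k)<0$, compute $x^{k+1}$ by the following Armijo line search; otherwise set $x^{k+1}=y^k$. Armijo line search: start with $\alpha=\bar\alpha$. While $\alpha>\varepsilon/\|d^k\|$: if $y^k+\alpha d^k\in\mathcal{C}$ and $f(y^k)-f(y^k+\alpha d^k)-\sigma\alpha^2\|d^k\|^2\ge0$, return $x^{k+1}=y^k+\alpha d^k$; else replace $\alpha$ by $\beta\alpha$. If the loop ends without returning, return $x^{k+1}=y^k$. DC critical point of (P): a point $x^*$ with $\partial(g+\chi_{\mathcal{C}})(x^* )\cap\partial h(x^* )\ne\emptyset$. Strongly DC critical point of (P): a point $x^*$ with $\emptyset\neq\partial h(x^* )\subset\partial(g+\chi_{\mathcal{C}})(x^* )$. Fréchet subdifferential of a proper closed $\phi:\mathbb{R}^n\to(-\infty,\infty]$ at $x\in\operatorname{dom}\phi$: $\partial^F\phi(x)=\{y:\liminf_{z\to x,z\ne x}\frac{\phi(z)-\phi(x)-\langle y,z-x\rangle}{\|z-x\|}\ge0\}$, and $\partial^F\phi(x)=\emptyset$ if $x\notin\operatorname{dom}\phi$. Limiting subdifferential: $\partial^L\phi(x)=\{y:\exists\,x^j\to x,\ \phi(x^j)\to\phi(x),\ y^j\in\partial^F\phi(x^j),\ y^j\to y\}$. A point $x^*$ is limiting-stationary for $\phi$ if $0\in\partial^L\phi(x^*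 )$. $\Phi$ verifies the Łojasiewicz subgradient inequality if for every limiting-stationary point $x^*$ of $\Phi$ there exist $\theta\in[0,1)$, $L>0$ and a neighbourhood $\mathcal{V}$ of $x^*$ such that $|\Phi(x)-\Phi(x^* )|^\theta\le L\|y\|$ for all $x\in\mathcal{V}$ and all $y\in\partial^L\Phi(x)$, with the convention $0^0=1$. *)

theory Defs
  imports "HOL-Analysis.Analysis"
begin

text \<open>
  Functions with values in \<open>(-\<infinity>, \<infinity>]\<close> are modelled with type \<open>ereal\<close>, where the convention
  \<open>\<infinity> - \<infinity> = \<infinity>\<close> is a library fact.
\<close>

definition eff_domain :: "('a \<Rightarrow> ereal) \<Rightarrow> 'a set" where
  "eff_domain \<phi> = {x. \<phi> x < \<infinity>}"

definition ereal_convex_on :: "'a::real_vector set \<Rightarrow> ('a \<Rightarrow> ereal) \<Rightarrow> bool" where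
  "ereal_convex_on S \<phi> \<longleftrightarrow> convex S \<and>
     (\<forall>x\<in>S. \<forall>y\<in>S. \<forall>a\<ge>0. \<forall>b\<ge>0. a + b = 1 \<longrightarrow>
        \<phi> (a *\<^sub>R x + b *\<^sub>R y) \<le> ereal a * \<phi> x + ereal b * \<phi> y)"

definition convex_with_modulus_on :: "'a::real_normed_vector set \<Rightarrow> real \<Rightarrow> ('a \<Rightarrow> ereal) \<Rightarrow> bool" where
  "convex_with_modulus_on S \<rho> \<phi> \<longleftrightarrow>
     ereal_convex_on S (\<lambda>x. \<phi> x - ereal (\<rho> / 2 * (norm x)\<^sup>2))"

text \<open>Closed proper convex functions; closedness is closedness of the epigraph.\<close>

definition Gamma0 :: "('a::real_normed_vector \<Rightarrow> ereal) set" where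
  "Gamma0 = {\<phi>. (\<forall>x. \<phi> x \<noteq> -\<infinity>) \<and> eff_domain \<phi> \<noteq> {} \<and> ereal_convex_on UNIV \<phi> \<and>
     closed {(x, r :: real). \<phi> x \<le> ereal r}}"

definition chi :: "'a set \<Rightarrow> 'a \<Rightarrow> ereal" where
  "chi S x = (if x \<in> S then 0 else \<infinity>)"

definition subdiff :: "('a::real_inner \<Rightarrow> ereal) \<Rightarrow> 'a \<Rightarrow> 'a set" where
  "subdiff \<phi> x = {z. \<bar>\<phi> x\<bar> \<noteq> \<infinity> \<and> (\<forall>w. \<phi> w \<ge> \<phi> x + ereal (z \<bullet> (w - x)))}"

definition affine_fun :: "('a::real_inner \<Rightarrow> real) \<Rightarrow> bool" where
  "affine_fun l \<longleftrightarrow> (\<exists>a b. \<forall>x. l x = a \<bullet> x + b)"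

definition active_set :: "nat \<Rightarrow> (nat \<Rightarrow> 'a \<Rightarrow> real) \<Rightarrow> 'a \<Rightarrow> nat set" where
  "active_set p u x = {i \<in> {1..p}. u i x = 0}"

definition has_dir_deriv :: "('a::real_vector \<Rightarrow> ereal) \<Rightarrow> 'a \<Rightarrow> 'a \<Rightarrow> ereal \<Rightarrow> bool" where
  "has_dir_deriv \<phi> x d l \<longleftrightarrow> ((\<lambda>t. (\<phi> (x + t *\<^sub>R d) - \<phi> x) / ereal t) \<longlongrightarrow> l) (at_right 0)"

text \<open>
  \<open>armijo C f \<beta> \<sigma> \<epsilon> y d \<alpha> r\<close>: the line-search loop, entered with current stepsize \<open>\<alpha>\<close>,
  terminates and returns \<open>r\<close>.  It is only called in descent directions, so \<open>d \<noteq> 0\<close> and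
  the quotient \<open>\<epsilon> / norm d\<close> is a genuine one.
\<close>

inductive armijo ::
  "'a::real_normed_vector set \<Rightarrow> ('a \<Rightarrow> ereal) \<Rightarrow> real \<Rightarrow> real \<Rightarrow> real \<Rightarrow> 'a \<Rightarrow> 'a \<Rightarrow> real \<Rightarrow> 'a \<Rightarrow> bool"
  for C f \<beta> \<sigma> \<epsilon> y d
where
  exhausted: "\<not> \<alpha> > \<epsilon> / norm d \<Longrightarrow> armijo C f \<beta> \<sigma> \<epsilon> y d \<alpha> y"
| accept: "\<lbrakk>\<alpha> > \<epsilon> / norm d;
     y + \<alpha> *\<^sub>R d \<in> C \<and> f y - f (y + \<alpha> *\<^sub>R d) - ereal (\<sigma> * \<alpha>\<^sup>2 * (norm d)\<^sup>2) \<ge> 0\<rbrakk>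
     \<Longrightarrow> armijo C f \<beta> \<sigma> \<epsilon> y d \<alpha> (y + \<alpha> *\<^sub>R d)"
| backtrack: "\<lbrakk>\<alpha> > \<epsilon> / norm d;
     \<not> (y + \<alpha> *\<^sub>R d \<in> C \<and> f y - f (y + \<alpha> *\<^sub>R d) - ereal (\<sigma> * \<alpha>\<^sup>2 * (norm d)\<^sup>2) \<ge> 0);
     armijo C f \<beta> \<sigma> \<epsilon> y d (\<beta> * \<alpha>) r\<rbrakk>
     \<Longrightarrow> armijo C f \<beta> \<sigma> \<epsilon> y d \<alpha> r"

text \<open>
  The choices of \<open>z k\<close> and \<open>y k\<close> are arbitrary, hence a predicate on sequences.  If the
  directional derivative does not exist in \<open>[-\<infinity>, \<infinity>]\<close>, the test \<open>f'(y; d) < 0\<close> counts as failed.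
\<close>

definition boosted_dca ::
  "'a::real_inner set \<Rightarrow> nat \<Rightarrow> (nat \<Rightarrow> 'a \<Rightarrow> real) \<Rightarrow> ('a \<Rightarrow> ereal) \<Rightarrow> ('a \<Rightarrow> ereal) \<Rightarrow>
   real \<Rightarrow> real \<Rightarrow> real \<Rightarrow> real \<Rightarrow> (nat \<Rightarrow> 'a) \<Rightarrow> (nat \<Rightarrow> 'a) \<Rightarrow> (nat \<Rightarrow> 'a) \<Rightarrow> bool" where
  "boosted_dca C p u g h \<alpha>0 \<beta> \<sigma> \<epsilon> x y z \<longleftrightarrow>
     (let f = (\<lambda>w. g w - h w) in
      \<forall>k. let d = y k - x k in
        z k \<in> subdiff h (x k) \<and>
        is_arg_min (\<lambda>w. g w - ereal (w \<bullet> z k)) (\<lambda>w. w \<in> C) (y k) \<and>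
        (if active_set p u (y k) \<subseteq> active_set p u (x k) \<and> (\<exists>l<0. has_dir_deriv f (y k) d l)
         then armijo C f \<beta> \<sigma> \<epsilon> (y k) d \<alpha>0 (x (Suc k))
         else x (Suc k) = y k))"

definition dc_critical ::
  "'a::real_inner set \<Rightarrow> ('a \<Rightarrow> ereal) \<Rightarrow> ('a \<Rightarrow> ereal) \<Rightarrow> 'a \<Rightarrow> bool" where
  "dc_critical C g h x \<longleftrightarrow> subdiff (\<lambda>w. g w + chi C w) x \<inter> subdiff h x \<noteq> {}"

definition strongly_dc_critical ::
  "'a::real_inner set \<Rightarrow> ('a \<Rightarrow> ereal) \<Rightarrow> ('a \<Rightarrow> ereal) \<Rightarrow> 'a \<Rightarrow> bool" where
  "strongly_dc_critical C g h x \<longleftrightarrow>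
     subdiff h x \<noteq> {} \<and> subdiff h x \<subseteq> subdiff (\<lambda>w. g w + chi C w) x"

definition seq_limit_point :: "(nat \<Rightarrow> 'a::topological_space) \<Rightarrow> 'a \<Rightarrow> bool" where
  "seq_limit_point x l \<longleftrightarrow> (\<exists>r :: nat \<Rightarrow> nat. strict_mono r \<and> (x \<circ> r) \<longlonglongrightarrow> l)"

definition frechet_subdiff :: "('a::real_inner \<Rightarrow> ereal) \<Rightarrow> 'a \<Rightarrow> 'a set" where
  "frechet_subdiff \<phi> x =
     (if x \<in> eff_domain \<phi>
      then {y. Liminf (at x) (\<lambda>z. (\<phi> z - \<phi> x - ereal (y \<bullet> (z - x))) / ereal (norm (z - x))) \<ge> 0}
      else {})"

definition limiting_subdiff :: "('a::real_inner \<Rightarrow> ereal) \<Rightarrow> 'a \<Rightarrow> 'a set" where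
  "limiting_subdiff \<phi> x =
     {y. \<exists>xs ys. xs \<longlonglongrightarrow> x \<and> (\<lambda>j. \<phi> (xs j)) \<longlonglongrightarrow> \<phi> x \<and>
           (\<forall>j. ys j \<in> frechet_subdiff \<phi> (xs j)) \<and> ys \<longlonglongrightarrow> y}"

text \<open>Real powers of elements of \<open>[0, \<infinity>]\<close> with \<open>0\<^sup>0 = 1\<close> (whereas \<open>0 powr 0 = 0\<close> on the reals).\<close>

definition epowr :: "ereal \<Rightarrow> real \<Rightarrow> ereal" where
  "epowr a \<theta> = (if \<theta> = 0 then 1 else if a = \<infinity> then \<infinity> else ereal (real_of_ereal a powr \<theta>))"

definition lojasiewicz :: "('a::real_inner \<Rightarrow> ereal) \<Rightarrow> bool" where
  "lojasiewicz \<phi> \<longleftrightarrow>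
     (\<forall>xs. 0 \<in> limiting_subdiff \<phi> xs \<longrightarrow>
       (\<exists>\<theta> L V. 0 \<le> \<theta> \<and> \<theta> < 1 \<and> L > 0 \<and> open V \<and> xs \<in> V \<and>
          (\<forall>x\<in>V. \<forall>y\<in>limiting_subdiff \<phi> x. epowr \<bar>\<phi> x - \<phi> xs\<bar> \<theta> \<le> ereal (L * norm y))))"

text \<open>Gradient of an extended-valued function at a point near which it is finite.\<close>

definition has_gradient :: "('a::real_inner \<Rightarrow> ereal) \<Rightarrow> 'a \<Rightarrow> 'a \<Rightarrow> bool" where
  "has_gradient \<phi> v x \<longleftrightarrow>
     (\<forall>\<^sub>F w in nhds x. \<bar>\<phi> w\<bar> \<noteq> \<infinity>) \<and> GDERIV (\<lambda>w. real_of_ereal (\<phi> w)) x :> v"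

text \<open>
  Continuous differentiability on some open set containing \<open>S\<close>; the functions that are
  continuously differentiable on the whole space are the instance \<open>U = UNIV\<close>.
\<close>

definition cont_diff_around :: "'a::real_inner set \<Rightarrow> ('a \<Rightarrow> ereal) \<Rightarrow> bool" where
  "cont_diff_around S \<phi> \<longleftrightarrow>
     (\<exists>U G. open U \<and> S \<subseteq> U \<and> (\<forall>x\<in>U. has_gradient \<phi> (G x) x) \<and> continuous_on U G)"

definition loc_lipschitz_gradient_on :: "'a::real_inner set \<Rightarrow> ('a \<Rightarrow> ereal) \<Rightarrow> bool" where
  "loc_lipschitz_gradient_on S \<phi> \<longleftrightarrow>
     (\<exists>G. (\<forall>x\<in>S. has_gradient \<phi> (G x) x) \<and>
          (\<forall>x\<in>S. \<exists>r>0. \<exists>L. lipschitz_on L (ball x r \<inter> S) G))"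

end

theory Submission
  imports Defs
begin

text \<open>
  Since \<open>z k\<close> is a subgradient of \<open>h\<close> at \<open>x k\<close> and of \<open>g + chi C\<close> at \<open>y k\<close>, the two moduli add up to
  the decrease \<open>f (x k) - f (y k) \<ge> c * (norm (x k - y k))\<^sup>2\<close>; the line search never increases \<open>f\<close>
  and moves by at most \<open>(1 + \<alpha>0) * norm (y k - x k)\<close>.  This gives square summability, and the
  closed graph of the subdifferential turns limit points into critical points.  For the finite
  length, \<open>z k - G (y k)\<close> with \<open>G\<close> the gradient of \<open>h\<close> is a limiting subgradient of \<open>\<Phi>\<close> at \<open>y k\<close>
  of norm at most a multiple of \<open>norm (x k - y k)\<close>.  The Lojasiewicz inequality is therefore used
  at the points \<open>y k\<close>: at \<open>x k\<close> no subgradient of \<open>g + chi C\<close> is known.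
\<close>

section \<open>Subgradients: quadratic growth, closed graph, uniqueness under
  differentiability\<close>

text \<open>Convexity of \<open>\<phi>\<close> minus the quadratic on the segment from
  \<open>a\<close> to \<open>b\<close>, compared with the supporting line at \<open>a\<close>, gives
  the bound after division by \<open>t\<close> and \<open>t\<close> tending to 0. Support is
  demanded on \<open>S\<close> only, because a subgradient of \<open>g + chi C\<close> supports
  \<open>g\<close> only on \<open>C\<close>.\<close>

lemma modulus_growth:
  fixes \<phi> :: "'a::real_inner \<Rightarrow> ereal"
  assumes mod: "convex_with_modulus_on S \<rho> \<phi>"
    and "a \<in> S" "b \<in> S"
    and \<alpha>: "\<phi> a = ereal \<alpha>" and \<beta>: "\<phi> b = ereal \<beta>"
    and supp: "\<And>w. w \<in> S \<Longrightarrow> \<phi> a + ereal (z \<bullet> (w - a)) \<le> \<phi> w"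
  shows "\<alpha> + z \<bullet> (b - a) + \<rho> / 2 * (norm (b - a))\<^sup>2 \<le> \<beta>"
proof -
  define R where "R = \<rho> / 2"
  have step: "z \<bullet> (b - a) + R * ((1 - t) * (norm (b - a))\<^sup>2) \<le> \<beta> - \<alpha>"
    if t: "0 < t" "t < 1" for t :: real
  proof -
    define w where "w = (1 - t) *\<^sub>R a + t *\<^sub>R b"
    have "convex S" and le: "\<phi> w - ereal (R * (norm w)\<^sup>2) \<le>
        ereal (1 - t) * (\<phi> a - ereal (R * (norm a)\<^sup>2)) + ereal t * (\<phi> b - ereal (R * (norm b)\<^sup>2))"
      using mod t \<open>a \<in> S\<close> \<open>b \<in> S\<close>
      unfolding convex_with_modulus_on_def ereal_convex_on_def w_def R_def by auto
    then have "w \<in> S"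
      using \<open>a \<in> S\<close> \<open>b \<in> S\<close> t unfolding w_def by (simp add: convex_def)
    have wa: "w - a = t *\<^sub>R (b - a)"
      unfolding w_def by (simp add: algebra_simps)
    have "ereal (\<alpha> + t * (z \<bullet> (b - a))) \<le> \<phi> w"
      using supp[OF \<open>w \<in> S\<close>] by (simp add: wa \<alpha>)
    then have "ereal (\<alpha> + t * (z \<bullet> (b - a)) - R * (norm w)\<^sup>2) \<le> \<phi> w - ereal (R * (norm w)\<^sup>2)"
      by (cases "\<phi> w") auto
    then have "\<alpha> + t * (z \<bullet> (b - a)) - R * (norm w)\<^sup>2
        \<le> (1 - t) * (\<alpha> - R * (norm a)\<^sup>2) + t * (\<beta> - R * (norm b)\<^sup>2)"
      using le by (simp add: \<alpha> \<beta> flip: ereal_less_eq(3))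
    \<comment> \<open>Exact convexity defect of the squared norm. Its factor
      \<open>t * (1 - t)\<close> is why the growth term has only the factor \<open>1 - t\<close>
      until the limit is taken.\<close>
    moreover have "(norm w)\<^sup>2 = (1 - t) * (norm a)\<^sup>2 + t * (norm b)\<^sup>2 - t * (1 - t) * (norm (b - a))\<^sup>2"
      unfolding w_def power2_norm_eq_inner
      by (simp add: inner_add_left inner_add_right inner_diff_left inner_diff_right inner_commute)
        (simp add: algebra_simps)
    then have "R * (norm w)\<^sup>2 =
        R * ((1 - t) * (norm a)\<^sup>2 + t * (norm b)\<^sup>2 - t * (1 - t) * (norm (b - a))\<^sup>2)"
      by simp
    ultimately have "t * (z \<bullet> (b - a) + R * ((1 - t) * (norm (b - a))\<^sup>2)) \<le> t * (\<beta> - \<alpha>)"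
      by (simp add: algebra_simps)
    then show ?thesis
      using t by simp
  qed
  have "((\<lambda>t. z \<bullet> (b - a) + R * ((1 - t) * (norm (b - a))\<^sup>2)) \<longlongrightarrow>
      z \<bullet> (b - a) + R * ((1 - 0) * (norm (b - a))\<^sup>2)) (at_right (0::real))"
    by (intro tendsto_intros)
  moreover have "\<forall>\<^sub>F t in at_right (0::real). z \<bullet> (b - a) + R * ((1 - t) * (norm (b - a))\<^sup>2) \<le> \<beta> - \<alpha>"
    using step by (auto simp: eventually_at_right_field intro!: exI[of _ 1])
  ultimately have "z \<bullet> (b - a) + R * ((1 - 0) * (norm (b - a))\<^sup>2) \<le> \<beta> - \<alpha>"
    by (intro tendsto_upperbound) auto
  then show ?thesis by (simp add: R_def)
qed

text \<open>Each subgradient inequality, read at a fixed \<open>w\<close>, places a point over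
  \<open>X k\<close> in the epigraph; closedness lets this pass to the limit. The values then
  converge because they lie between the support at \<open>a\<close> and the supports at
  \<open>X k\<close>.\<close>

lemma subdiff_closed_graph:
  fixes \<phi> :: "'a::real_inner \<Rightarrow> ereal"
  assumes closed: "closed {(x, r :: real). \<phi> x \<le> ereal r}"
    and proper: "\<And>w. \<phi> w \<noteq> -\<infinity>"
    and X: "X \<longlonglongrightarrow> a" and Z: "Z \<longlonglongrightarrow> \<zeta>"
    and sub: "\<And>k. Z k \<in> subdiff \<phi> (X k)"
  shows "\<zeta> \<in> subdiff \<phi> a" and "(\<lambda>k. \<phi> (X k)) \<longlonglongrightarrow> \<phi> a"
proof -
  have fin: "\<bar>\<phi> (X k)\<bar> \<noteq> \<infinity>" and supp: "\<phi> (X k) + ereal (Z k \<bullet> (w - X k)) \<le> \<phi> w" for k w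
    using sub[of k] by (auto simp: subdiff_def)
  define c where "c k = real_of_ereal (\<phi> (X k))" for k
  have c: "\<phi> (X k) = ereal (c k)" for k
    using fin[of k] by (simp add: c_def ereal_real)
  \<comment> \<open>Used twice: \<open>w = X 0\<close> shows that \<open>\<phi> a\<close> is finite,
    and general \<open>w\<close> gives the subgradient inequality at \<open>a\<close>.\<close>
  have upper: "\<phi> a \<le> ereal (r - \<zeta> \<bullet> (w - a))" if w: "\<phi> w = ereal r" for w r
  proof -
    have "(X k, r - Z k \<bullet> (w - X k)) \<in> {(x, r). \<phi> x \<le> ereal r}" for k
      using supp[of k w] by (simp add: w c)
    moreover have "(\<lambda>k. (X k, r - Z k \<bullet> (w - X k))) \<longlonglongrightarrow> (a, r - \<zeta> \<bullet> (w - a))"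
      by (intro tendsto_intros X Z)
    ultimately have "(a, r - \<zeta> \<bullet> (w - a)) \<in> {(x, r). \<phi> x \<le> ereal r}"
      by (rule closed_sequentially[OF closed])
    then show ?thesis by simp
  qed
  obtain s where s: "\<phi> a = ereal s"
    using upper[OF c[of 0]] proper[of a] by (cases "\<phi> a") auto
  show in_sub: "\<zeta> \<in> subdiff \<phi> a"
  proof -
    have "\<phi> a + ereal (\<zeta> \<bullet> (w - a)) \<le> \<phi> w" for w
      using upper[of w] proper[of w] s by (cases "\<phi> w") auto
    then show ?thesis using s by (simp add: subdiff_def)
  qed
  have "c \<longlonglongrightarrow> s"
  proof (rule tendsto_sandwich)
    show "\<forall>\<^sub>F k in sequentially. s + \<zeta> \<bullet> (X k - a) \<le> c k"
    proof (intro always_eventually allI)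
      fix k
      have "\<phi> a + ereal (\<zeta> \<bullet> (X k - a)) \<le> \<phi> (X k)"
        using in_sub by (simp add: subdiff_def)
      then show "s + \<zeta> \<bullet> (X k - a) \<le> c k" by (simp add: s c)
    qed
    show "\<forall>\<^sub>F k in sequentially. c k \<le> s - Z k \<bullet> (a - X k)"
    proof (intro always_eventually allI)
      fix k show "c k \<le> s - Z k \<bullet> (a - X k)"
        using supp[of k a] by (simp add: s c)
    qed
    have "(\<lambda>k. s + \<zeta> \<bullet> (X k - a)) \<longlonglongrightarrow> s + \<zeta> \<bullet> (a - a)"
      by (intro tendsto_intros X)
    then show "(\<lambda>k. s + \<zeta> \<bullet> (X k - a)) \<longlonglongrightarrow> s" by simp
    have "(\<lambda>k. s - Z k \<bullet> (a - X k)) \<longlonglongrightarrow> s - \<zeta> \<bullet> (a - a)"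
      by (intro tendsto_intros X Z)
    then show "(\<lambda>k. s - Z k \<bullet> (a - X k)) \<longlonglongrightarrow> s" by simp
  qed
  then show "(\<lambda>k. \<phi> (X k)) \<longlonglongrightarrow> \<phi> a"
    by (simp add: c s)
qed

text \<open>Subtracting the linear support leaves a function with a local minimum at
  \<open>x\<close>, so its derivative \<open>v - z\<close> vanishes.\<close>

lemma subdiff_unique_gradient:
  assumes grad: "has_gradient \<phi> v x" and z: "z \<in> subdiff \<phi> x"
  shows "z = v"
proof -
  define F where "F w = real_of_ereal (\<phi> w) - z \<bullet> (w - x)" for w
  have "((\<lambda>w. real_of_ereal (\<phi> w)) has_derivative (\<lambda>d. d \<bullet> v)) (at x)"
    using grad by (simp add: has_gradient_def gderiv_def)
  then have der: "(F has_derivative (\<lambda>d. d \<bullet> v - z \<bullet> d)) (at x)"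
    unfolding F_def by (auto intro!: derivative_eq_intros)
  have fin: "\<forall>\<^sub>F w in at x. \<bar>\<phi> w\<bar> \<noteq> \<infinity>"
    using grad by (auto simp: has_gradient_def eventually_nhds_conv_at)
  have "\<forall>\<^sub>F w in at x. F x \<le> F w"
    using fin
  proof eventually_elim
    case (elim w)
    have "\<bar>\<phi> x\<bar> \<noteq> \<infinity>" "\<phi> x + ereal (z \<bullet> (w - x)) \<le> \<phi> w"
      using z by (auto simp: subdiff_def)
    then show ?case
      using elim by (cases "\<phi> x"; cases "\<phi> w") (auto simp: F_def)
  qed
  from has_derivative_local_min[OF der this] have "(v - z) \<bullet> (v - z) = 0"
    by (metis inner_commute inner_diff_left)
  then show ?thesis by simp
qed

section \<open>Frechet and limiting subgradients of a difference\<close>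

text \<open>The subgradient bounds the increment of \<open>\<phi>\<close> from below without error,
  and the gradient describes that of \<open>h\<close> up to \<open>o(norm (w - x))\<close>; so the
  quotient of the difference is eventually above every negative number.\<close>

lemma frechet_subdiff_diff:
  fixes \<phi> h :: "'a::real_inner \<Rightarrow> ereal"
  assumes proper: "\<And>w. \<phi> w \<noteq> -\<infinity>"
    and z: "z \<in> subdiff \<phi> x" and grad: "has_gradient h v x"
  shows "z - v \<in> frechet_subdiff (\<lambda>w. \<phi> w - h w) x"
proof -
  have hfin: "\<bar>h x\<bar> \<noteq> \<infinity>" and ev: "\<forall>\<^sub>F w in at x. \<bar>h w\<bar> \<noteq> \<infinity>"
    using grad by (auto simp: has_gradient_def eventually_nhds_conv_at)
  obtain a where a: "\<phi> x = ereal a" using z by (auto simp: subdiff_def)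
  define H where "H w = real_of_ereal (h w)" for w
  have hx: "h x = ereal (H x)" using hfin by (simp add: H_def ereal_real)
  have der: "((\<lambda>w. (1 / norm (w - x)) *\<^sub>R (H w - (H x + (w - x) \<bullet> v))) \<longlongrightarrow> 0) (at x)"
    using grad unfolding has_gradient_def gderiv_def H_def has_derivative_within by blast
  have "0 \<le> Liminf (at x) (\<lambda>w. (\<phi> w - h w - (\<phi> x - h x) - ereal ((z - v) \<bullet> (w - x))) / ereal (norm (w - x)))"
    unfolding le_Liminf_iff
  proof (intro allI impI)
    fix y :: ereal assume "y < 0"
    then obtain e where e: "e > 0" "y < ereal (- e)"
      by (metis ereal_dense2 ereal_less(2) ereal_less_uminus_reorder ereal_uminus_uminus less_ereal.simps(1) uminus_ereal.simps(1) zero_ereal_def neg_less_0_iff_less)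
    have "\<forall>\<^sub>F w in at x. \<bar>(1 / norm (w - x)) *\<^sub>R (H w - (H x + (w - x) \<bullet> v))\<bar> < e"
      using tendstoD[OF der \<open>e > 0\<close>] by (simp add: dist_real_def)
    moreover have "\<forall>\<^sub>F w in at x. w \<noteq> x"
      by (simp add: eventually_at_filter)
    ultimately show "\<forall>\<^sub>F w in at x. y < (\<phi> w - h w - (\<phi> x - h x) - ereal ((z - v) \<bullet> (w - x))) / ereal (norm (w - x))"
      using ev
    proof eventually_elim
      case (elim w)
      then have hw: "h w = ereal (H w)" and n: "norm (w - x) > 0"
        by (auto simp: H_def ereal_real)
      show ?case
      proof (cases "\<phi> w")
        case (real b)
        have "a + z \<bullet> (w - x) \<le> b"
          using z real by (auto simp: subdiff_def a dest!: spec[of _ w])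
        moreover have "H w - H x - (w - x) \<bullet> v < e * norm (w - x)"
          using elim(1) n by (simp add: abs_less_iff field_simps)
        moreover have "(z - v) \<bullet> (w - x) = z \<bullet> (w - x) - (w - x) \<bullet> v"
          by (simp add: inner_diff_left inner_diff_right inner_commute)
        ultimately have "- e * norm (w - x) < b - H w - (a - H x) - (z - v) \<bullet> (w - x)"
          by linarith
        then have "- e < (b - H w - (a - H x) - (z - v) \<bullet> (w - x)) / norm (w - x)"
          using n by (simp add: pos_less_divide_eq)
        then have "ereal (- e) < (\<phi> w - h w - (\<phi> x - h x) - ereal ((z - v) \<bullet> (w - x))) / ereal (norm (w - x))"
          using n by (simp add: real hw hx a)
        then show ?thesis using e(2) by (rule less_trans[rotated])
      next
        case PInf
        then show ?thesis using n e by (auto simp: hw hx a)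
      next
        case MInf
        then show ?thesis using proper by blast
      qed
    qed
  qed
  then show ?thesis
    by (simp add: frechet_subdiff_def eff_domain_def a hx)
qed

lemma frechet_subset_limiting_subdiff: "frechet_subdiff \<phi> x \<subseteq> limiting_subdiff \<phi> x"
proof
  fix y assume "y \<in> frechet_subdiff \<phi> x"
  then show "y \<in> limiting_subdiff \<phi> x"
    unfolding limiting_subdiff_def
    by (intro CollectI exI[of _ "\<lambda>_. x"] exI[of _ "\<lambda>_. y"]) simp
qed

section \<open>The line search\<close>

text \<open>Backtracking only shrinks the stepsize, and a failed search is the case
  \<open>t = 0\<close>. On acceptance the term with \<open>\<sigma>\<close> is nonnegative, so the
  test implies that \<open>f\<close> does not increase.\<close>

lemma armijo_result:
  assumes "armijo C f \<beta> \<sigma> \<epsilon> y d \<alpha> r"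
    and "\<alpha> \<ge> 0" "0 < \<beta>" "\<beta> < 1" "0 \<le> \<sigma>" "y \<in> C" "\<bar>f y\<bar> \<noteq> \<infinity>"
  shows "\<exists>t. 0 \<le> t \<and> t \<le> \<alpha> \<and> r = y + t *\<^sub>R d \<and> r \<in> C \<and> f r \<le> f y"
  using assms
proof induction
  case (exhausted \<alpha>)
  then show ?case by (auto intro!: exI[of _ 0])
next
  case (accept \<alpha>)
  let ?r = "y + \<alpha> *\<^sub>R d"
  define c where "c = \<sigma> * \<alpha>\<^sup>2 * (norm d)\<^sup>2"
  have "c \<ge> 0" using accept by (simp add: c_def)
  moreover have "f y - f ?r - ereal c \<ge> 0" "\<bar>f y\<bar> \<noteq> \<infinity>"
    using accept by (auto simp: c_def)
  ultimately have "f ?r \<le> f y"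
    by (cases "f y"; cases "f ?r") auto
  then show ?case using accept by (auto intro!: exI[of _ \<alpha>])
next
  case (backtrack \<alpha> r)
  then obtain t where "0 \<le> t" "t \<le> \<beta> * \<alpha>" "r = y + t *\<^sub>R d" "r \<in> C" "f r \<le> f y"
    by auto
  moreover have "\<beta> * \<alpha> \<le> \<alpha>"
    using backtrack by (simp add: mult_left_le_one_le)
  ultimately show ?case by (intro exI[of _ t]) auto
qed

section \<open>The Lojasiewicz inequality and finite length\<close>

text \<open>Tangent inequality for the concave function \<open>s powr (1 - \<theta>)\<close> at
  \<open>t\<close>, multiplied by \<open>t powr \<theta>\<close>. For \<open>s > 0\<close> it is
  Young's inequality.\<close>

lemma powr_tangent_ge:
  fixes s t \<theta> :: real
  assumes "0 < t" "0 \<le> s" "0 \<le> \<theta>" "\<theta> < 1"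
  shows "(1 - \<theta>) * (t - s) \<le> t powr \<theta> * (t powr (1 - \<theta>) - s powr (1 - \<theta>))"
proof (cases "s = 0")
  case True
  have "t powr \<theta> * t powr (1 - \<theta>) = t"
    using assms by (simp flip: powr_add)
  then show ?thesis using True assms by (simp add: algebra_simps)
next
  case False
  then have "s powr (1 - \<theta>) * t powr \<theta> \<le> (1 - \<theta>) * s + \<theta> * t"
    using assms by (intro Youngs_inequality_0) auto
  moreover have "t powr \<theta> * t powr (1 - \<theta>) = t"
    using assms by (simp flip: powr_add)
  ultimately show ?thesis by (simp add: algebra_simps)
qed

text \<open>Here \<open>t\<close>, \<open>t'\<close> are consecutive gaps to the limit value and
  \<open>D\<close>, \<open>D'\<close> consecutive step lengths. Concavity turns descent into a
  decrease of \<open>t powr (1 - \<theta>)\<close>, and the inequality of arithmetic and geometric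
  means splits the resulting product into a sum that telescopes.\<close>

lemma KL_step:
  fixes t t' D D' M c \<theta> :: real
  assumes \<theta>: "0 \<le> \<theta>" "\<theta> < 1" and pos: "c > 0" "M > 0" "D \<ge> 0" and t: "0 \<le> t" "0 \<le> t'"
    and desc: "c * D'\<^sup>2 \<le> t - t'"
    and KL: "t > 0 \<Longrightarrow> t powr \<theta> \<le> M * D"
  shows "2 * D' \<le> D + M / ((1 - \<theta>) * c) * (t powr (1 - \<theta>) - t' powr (1 - \<theta>))"
proof (cases "t = 0")
  \<comment> \<open>At gap 0 the assumption \<open>KL\<close> says nothing, but descent already
    forces \<open>D' = 0\<close>.\<close>
  case True
  with desc t pos have "t' = 0" "D' = 0"
    by (smt (verit) mult_nonneg_nonneg zero_le_power2 mult_eq_0_iff power_eq_0_iff)+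
  then show ?thesis using True pos by simp
next
  case False
  then have "t > 0" using t by simp
  define K where "K = M / ((1 - \<theta>) * c)"
  define \<Delta> where "\<Delta> = t powr (1 - \<theta>) - t' powr (1 - \<theta>)"
  have "t' \<le> t" using desc pos by (smt (verit) mult_nonneg_nonneg zero_le_power2)
  then have \<Delta>: "\<Delta> \<ge> 0" using \<theta> t by (simp add: \<Delta>_def powr_mono2)
  have "K \<ge> 0" using pos \<theta> by (simp add: K_def)
  have "(1 - \<theta>) * (c * D'\<^sup>2) \<le> (1 - \<theta>) * (t - t')"
    using desc \<theta> by (intro mult_left_mono) auto
  also have "\<dots> \<le> t powr \<theta> * \<Delta>"
    unfolding \<Delta>_def using \<open>t > 0\<close> t \<theta> by (intro powr_tangent_ge) auto
  also have "\<dots> \<le> M * D * \<Delta>"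
    using KL \<open>t > 0\<close> \<Delta> by (intro mult_right_mono) auto
  finally have "D'\<^sup>2 \<le> D * (K * \<Delta>)"
    using pos \<theta> by (simp add: K_def field_simps)
  then have "(2 * D')\<^sup>2 \<le> 4 * (D * (K * \<Delta>))"
    by (simp add: power_mult_distrib)
  also have "\<dots> \<le> (D + K * \<Delta>)\<^sup>2"
    using zero_le_power2[of "D - K * \<Delta>"] by (simp add: power2_eq_square algebra_simps)
  finally have "2 * D' \<le> D + K * \<Delta>"
    by (rule power2_le_imp_le) (use \<open>D \<ge> 0\<close> \<open>K \<ge> 0\<close> \<Delta> in simp)
  then show ?thesis by (simp add: K_def \<Delta>_def)
qed

text \<open>
  Telescoping the one-step estimate bounds the path length from step \<open>N\<close> on by a quantity that
  is small along a subsequence approaching \<open>a\<close>; hence the iterates never leave the ball on which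
  the inequality is available.
\<close>

lemma KL_finite_length:
  fixes X Y :: "nat \<Rightarrow> 'a::real_normed_vector" and D t :: "nat \<Rightarrow> real"
  assumes \<theta>: "0 \<le> \<theta>" "\<theta> < 1" and pos: "c > 0" "M > 0" "B \<ge> 0" "e > 0"
    and D: "\<And>k. D k = norm (Y k - X k)"
    and X_step: "\<And>k. norm (X (Suc k) - X k) \<le> B * D k"
    and t: "\<And>k. 0 \<le> t k" "t \<longlonglongrightarrow> 0"
    and desc: "\<And>k. c * (D (Suc k))\<^sup>2 \<le> t k - t (Suc k)"
    and D0: "D \<longlonglongrightarrow> 0"
    and r: "strict_mono r" "(X \<circ> r) \<longlonglongrightarrow> a"
    and KL: "\<And>k. X k \<in> ball a e \<Longrightarrow> Y k \<in> ball a e \<Longrightarrow> t k > 0 \<Longrightarrow> t k powr \<theta> \<le> M * D k"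
  shows "summable D"
proof -
  define K where "K = M / ((1 - \<theta>) * c)"
  define \<phi> where "\<phi> k = t k powr (1 - \<theta>)" for k
  \<comment> \<open>\<open>A N\<close> bounds the distance from \<open>a\<close> of all later
    iterates. One \<open>D N\<close> comes from telescoping the estimate of \<open>KL_step\<close>,
    the other from passing from the sum of \<open>D (Suc k)\<close> to that of
    \<open>D k\<close>.\<close>
  define A where "A n = norm (X n - a) + B * (2 * D n + K * \<phi> n)" for n
  have K: "K \<ge> 0" and \<phi>: "\<phi> k \<ge> 0" and D_nonneg: "D k \<ge> 0" for k
    using pos \<theta> by (auto simp: K_def \<phi>_def D)
  have "\<phi> \<longlonglongrightarrow> 0"
    unfolding \<phi>_def using t \<theta> tendsto_powr'[OF t(2) tendsto_const[of "1 - \<theta>"]] by simp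
  then have "(\<phi> \<circ> r) \<longlonglongrightarrow> 0" "(D \<circ> r) \<longlonglongrightarrow> 0"
    using D0 r(1) by (auto intro: LIMSEQ_subseq_LIMSEQ)
  then have "(\<lambda>j. norm ((X \<circ> r) j - a) + B * (2 * (D \<circ> r) j + K * (\<phi> \<circ> r) j)) \<longlonglongrightarrow>
      norm (a - a) + B * (2 * 0 + K * 0)"
    by (intro tendsto_intros r(2))
  then have "(\<lambda>j. A (r j)) \<longlonglongrightarrow> 0" by (simp add: A_def)
  then have evA: "\<forall>\<^sub>F j in sequentially. A (r j) < e / 2"
    using pos by (intro order_tendstoD(2)[where a = "e / 2"]) auto
  have "\<forall>\<^sub>F k in sequentially. D k < e / 2"
    using order_tendstoD(2)[OF D0, of "e / 2"] pos by simp
  then obtain N0 where N0: "\<And>k. k \<ge> N0 \<Longrightarrow> D k < e / 2"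
    by (auto simp: eventually_sequentially)
  obtain j where j: "j \<ge> N0" "A (r j) < e / 2"
    using eventually_conj[OF evA eventually_ge_at_top[of N0]]
    by (metis (mono_tags, lifting) eventually_happens trivial_limit_sequentially)
  define N where "N = r j"
  \<comment> \<open>The smallness of \<open>A N\<close> keeps each later \<open>X n\<close> within
    \<open>e / 2\<close> of \<open>a\<close>; \<open>D n < e / 2\<close> from \<open>N0\<close> on
    then keeps \<open>Y n\<close> within \<open>e\<close>.\<close>
  have N: "N \<ge> N0" "A N < e / 2"
    using j seq_suble[OF r(1), of j] by (auto simp: N_def)
  have shift: "(\<Sum>k=N..<n. D k) + D n = D N + (\<Sum>k=N..<n. D (Suc k))" if "n \<ge> N" for n
    using that by (induction n rule: dec_induct) auto
  \<comment> \<open>Length and distance are proved together: the next length estimate needs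
    \<open>X n\<close> and \<open>Y n\<close> in the ball, which follows from the length so far. The
    extra \<open>D n\<close> on the left absorbs the \<open>D n\<close> on the right of
    \<open>KL_step\<close>.\<close>
  have main: "(\<Sum>k=N..<n. D (Suc k)) + D n \<le> D N + K * (\<phi> N - \<phi> n) \<and>
      norm (X n - a) \<le> norm (X N - a) + B * (\<Sum>k=N..<n. D k)" if "n \<ge> N" for n
    using that
  proof (induction n rule: dec_induct)
    case base
    then show ?case by simp
  next
    case (step n)
    have "(\<Sum>k=N..<n. D k) \<le> 2 * D N + K * \<phi> N"
    proof -
      have "0 \<le> K * \<phi> n" using K \<phi> by simp
      then show ?thesis using shift[OF step.hyps(1)] step.IH D_nonneg[of n] by (simp add: right_diff_distrib)
    qed
    then have "norm (X n - a) \<le> A N"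
      using step.IH pos(3) unfolding A_def by (smt (verit) mult_left_mono)
    then have near: "norm (X n - a) < e / 2" using N by simp
    have "norm (Y n - a) \<le> D n + norm (X n - a)"
      using norm_triangle_ineq[of "Y n - X n" "X n - a"] by (simp add: D)
    then have "norm (Y n - a) < e"
      using near N0[of n] N step.hyps by simp
    then have "t n > 0 \<Longrightarrow> t n powr \<theta> \<le> M * D n"
      using near pos by (intro KL) (auto simp: dist_norm norm_minus_commute)
    from KL_step[OF \<theta> pos(1,2) D_nonneg t(1) t(1) desc this]
    have "2 * D (Suc n) \<le> D n + K * (\<phi> n - \<phi> (Suc n))"
      by (simp add: K_def \<phi>_def)
    moreover have "norm (X (Suc n) - a) \<le> B * D n + norm (X n - a)"
      using norm_triangle_ineq[of "X (Suc n) - X n" "X n - a"] X_step[of n] by simp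
    ultimately show ?case
      using step by (simp add: algebra_simps)
  qed
  have "summable (\<lambda>k. D (Suc (N + k)))"
  proof (rule summableI_nonneg_bounded[where x = "D N + K * \<phi> N"])
    fix n
    have "0 \<le> K * \<phi> (N + n)" using K \<phi> by simp
    moreover have "(\<Sum>k<n. D (Suc (N + k))) = (\<Sum>k=N..<N+n. D (Suc k))"
      using sum.shift_bounds_nat_ivl[of "\<lambda>k. D (Suc k)" 0 N n]
      by (simp add: atLeast0LessThan add.commute)
    ultimately show "(\<Sum>k<n. D (Suc (N + k))) \<le> D N + K * \<phi> N"
      using main[of "N + n"] D_nonneg[of "N + n"] by (simp add: right_diff_distrib)
  qed (rule D_nonneg)
  then show ?thesis
    using summable_iff_shift[of D "Suc N"] by (simp add: add.commute)
qed

section \<open>Criticality, the feasible set and one iteration of the algorithm\<close>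

lemma dc_critical_imp_strongly:
  assumes "dc_critical C g h x" and "has_gradient h v x"
  shows "strongly_dc_critical C g h x"
  using assms subdiff_unique_gradient[OF assms(2)]
  unfolding dc_critical_def strongly_dc_critical_def by blast

lemma epigraph_add_chi: "{(x, r :: real). g x + chi C x \<le> ereal r} = {(x, r). g x \<le> ereal r} \<inter> C \<times> UNIV"
  by (auto simp: chi_def split: if_splits)

text \<open>Finite convex functions on a Euclidean space are continuous, so closedness of the
  feasible set follows from the form of its constraints.\<close>

lemma closed_convex_constraints:
  fixes u v :: "nat \<Rightarrow> 'a::euclidean_space \<Rightarrow> real"
  assumes u: "\<And>i. i \<in> I \<Longrightarrow> convex_on UNIV (u i)" and v: "\<And>j. j \<in> J \<Longrightarrow> affine_fun (v j)"
  shows "closed {w. (\<forall>i\<in>I. u i w \<le> 0) \<and> (\<forall>j\<in>J. v j w = 0)}"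
proof -
  have "continuous_on UNIV (u i)" if "i \<in> I" for i
    using convex_on_continuous[OF open_UNIV u[OF that]] .
  moreover have "continuous_on UNIV (v j)" if j: "j \<in> J" for j
  proof -
    obtain a b where "\<And>x. v j x = a \<bullet> x + b"
      using v[OF j] by (auto simp: affine_fun_def)
    then have "v j = (\<lambda>x. a \<bullet> x + b)" by auto
    then show ?thesis by (simp add: continuous_intros)
  qed
  ultimately have "closed ((\<Inter>i\<in>I. {w. u i w \<le> 0}) \<inter> (\<Inter>j\<in>J. {w. v j w = 0}))"
    by (intro closed_Int closed_INT ballI closed_Collect_le closed_Collect_eq continuous_on_const)
  moreover have "(\<Inter>i\<in>I. {w. u i w \<le> 0}) \<inter> (\<Inter>j\<in>J. {w. v j w = 0}) =
      {w. (\<forall>i\<in>I. u i w \<le> 0) \<and> (\<forall>j\<in>J. v j w = 0)}"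
    by auto
  ultimately show ?thesis by simp
qed

text \<open>Optimality in the linearised subproblem, rearranged, is the subgradient inequality. The
  feasible point \<open>w0\<close> with \<open>g w0\<close> finite ensures that \<open>g y\<close>
  is finite, as \<open>subdiff\<close> demands.\<close>

lemma arg_min_on_imp_subdiff:
  fixes g :: "'a::real_inner \<Rightarrow> ereal"
  assumes proper: "\<And>w. g w \<noteq> -\<infinity>" and dom: "w0 \<in> C" "g w0 \<noteq> \<infinity>"
    and min: "is_arg_min (\<lambda>w. g w - ereal (w \<bullet> z)) (\<lambda>w. w \<in> C) y"
  shows "y \<in> C" and "z \<in> subdiff (\<lambda>w. g w + chi C w) y"
proof -
  show y: "y \<in> C" using min by (simp add: is_arg_min_def)
  have le: "g y - ereal (y \<bullet> z) \<le> g w - ereal (w \<bullet> z)" if "w \<in> C" for w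
    using min that by (simp add: is_arg_min_linorder)
  have fin: "\<bar>g y\<bar> \<noteq> \<infinity>"
    using le[OF dom(1)] dom(2) proper[of y] proper[of w0]
    by (cases "g y"; cases "g w0") auto
  have "g y + ereal (z \<bullet> (w - y)) \<le> g w" if "w \<in> C" for w
    using le[OF that] fin proper[of w]
    by (cases "g y"; cases "g w") (auto simp: inner_diff_right inner_commute)
  then show "z \<in> subdiff (\<lambda>w. g w + chi C w) y"
    using y fin by (auto simp: subdiff_def chi_def)
qed

text \<open>Both branches have the form \<open>y k + t *\<^sub>R (y k - x k)\<close>, with
  \<open>t = 0\<close> if no search takes place; measured from \<open>x k\<close> the displacement
  is \<open>1 + t\<close> times the direction.\<close>

lemma boosted_dca_step:
  assumes dca: "boosted_dca C p u g h \<alpha>0 \<beta> \<sigma> \<epsilon> x y z"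
    and params: "0 \<le> \<alpha>0" "0 < \<beta>" "\<beta> < 1" "0 \<le> \<sigma>"
    and y: "y k \<in> C" "\<bar>g (y k) - h (y k)\<bar> \<noteq> \<infinity>"
  shows "x (Suc k) \<in> C" and "g (x (Suc k)) - h (x (Suc k)) \<le> g (y k) - h (y k)"
    and "norm (x (Suc k) - x k) \<le> (1 + \<alpha>0) * norm (y k - x k)"
proof -
  define f where "f w = g w - h w" for w
  have "x (Suc k) = y k \<or> armijo C f \<beta> \<sigma> \<epsilon> (y k) (y k - x k) \<alpha>0 (x (Suc k))"
    using dca unfolding boosted_dca_def f_def Let_def by metis
  then have "\<exists>t. 0 \<le> t \<and> t \<le> \<alpha>0 \<and> x (Suc k) = y k + t *\<^sub>R (y k - x k) \<and> x (Suc k) \<in> C \<and>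
      f (x (Suc k)) \<le> f (y k)"
  proof
    assume "x (Suc k) = y k"
    then show ?thesis using params y by (intro exI[of _ 0]) auto
  next
    assume "armijo C f \<beta> \<sigma> \<epsilon> (y k) (y k - x k) \<alpha>0 (x (Suc k))"
    from armijo_result[OF this] show ?thesis using params y by (simp add: f_def)
  qed
  then obtain t where t: "0 \<le> t" "t \<le> \<alpha>0" "x (Suc k) = y k + t *\<^sub>R (y k - x k)"
    and *: "x (Suc k) \<in> C" "f (x (Suc k)) \<le> f (y k)" by blast
  then show "x (Suc k) \<in> C" "g (x (Suc k)) - h (x (Suc k)) \<le> g (y k) - h (y k)"
    by (simp_all add: f_def)
  have "x (Suc k) - x k = (1 + t) *\<^sub>R (y k - x k)"
    by (simp add: t algebra_simps)
  then have "norm (x (Suc k) - x k) = (1 + t) * norm (y k - x k)"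
    using t by simp
  then show "norm (x (Suc k) - x k) \<le> (1 + \<alpha>0) * norm (y k - x k)"
    using t by (simp add: mult_right_mono)
qed

theorem theorem11:
  fixes g h f \<Phi> :: "real ^ 'n \<Rightarrow> ereal"
    and p q :: nat
    and u v :: "nat \<Rightarrow> real ^ 'n \<Rightarrow> real"
    and C :: "(real ^ 'n) set"
    and x y z :: "nat \<Rightarrow> real ^ 'n"
    and \<rho>g \<rho>h \<alpha>0 \<beta> \<sigma> \<epsilon> :: real
  assumes g: "g \<in> Gamma0" and h: "h \<in> Gamma0"
    and u: "\<And>i. i \<in> {1..p} \<Longrightarrow> convex_on UNIV (u i)"
    and v: "\<And>j. j \<in> {1..q} \<Longrightarrow> affine_fun (v j)"
    and C: "C = {w. (\<forall>i\<in>{1..p}. u i w \<le> 0) \<and> (\<forall>j\<in>{1..q}. v j w = 0)}"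
    and C_nonempty: "C \<noteq> {}"
    and f: "f = (\<lambda>w. g w - h w)"
    and \<Phi>: "\<Phi> = (\<lambda>w. f w + chi C w)"
    and finite_value: "\<bar>INF w. (g w + chi C w) - h w\<bar> \<noteq> \<infinity>"
    and params: "\<alpha>0 > 0" "0 < \<beta>" "\<beta> < 1" "0 < \<sigma>" "\<sigma> < 1" "\<epsilon> > 0"
    and x0: "subdiff h (x 0) \<noteq> {}"
    and dca: "boosted_dca C p u g h \<alpha>0 \<beta> \<sigma> \<epsilon> x y z"
    and \<rho>g: "\<rho>g \<ge> 0" "convex_with_modulus_on C \<rho>g g"
    and \<rho>h: "\<rho>h \<ge> 0" "convex_with_modulus_on C \<rho>h h"
    and strongly: "\<rho>g + \<rho>h > 0"
    and bdd: "bounded (range (\<lambda>k. (x k, y k, z k)))"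
    and bdd_below: "\<exists>M :: real. \<forall>w\<in>C. f w \<ge> ereal M"
  shows
    "(\<forall>k\<ge>1. f (x k) - f (y k) \<ge> ereal ((\<rho>g + \<rho>h) / 2 * (norm (x k - y k))\<^sup>2))
     \<and>
     ((\<forall>k\<ge>1. \<bar>f (x k)\<bar> \<noteq> \<infinity> \<and> f (x (Suc k)) \<le> f (x k)) \<and>
      (\<exists>l :: real. (\<lambda>k. f (x k)) \<longlonglongrightarrow> ereal l))
     \<and>
     ((\<lambda>k. norm (x k - y k)) \<longlonglongrightarrow> 0 \<and> (\<lambda>k. norm (x k - x (Suc k))) \<longlonglongrightarrow> 0)
     \<and>
     (summable (\<lambda>k. (norm (y k - x k))\<^sup>2) \<and> summable (\<lambda>k. (norm (x (Suc k) - x k))\<^sup>2))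
     \<and>
     ((\<forall>xs. seq_limit_point x xs \<longrightarrow> dc_critical C g h xs) \<and>
      (cont_diff_around (C \<inter> eff_domain g) h \<longrightarrow>
        (\<forall>xs. seq_limit_point x xs \<longrightarrow> strongly_dc_critical C g h xs)))
     \<and>
     (lojasiewicz \<Phi> \<and> loc_lipschitz_gradient_on C h \<longrightarrow>
       (summable (\<lambda>k. norm (y k - x k)) \<and> summable (\<lambda>k. norm (x (Suc k) - x k)))
       \<and>
       (\<exists>xs. x \<longlonglongrightarrow> xs \<and> strongly_dc_critical C g h xs))"
proof -

  \<comment> \<open>Finiteness and feasibility of the iterates\<close>
  have g_proper: "g w \<noteq> -\<infinity>" and h_proper: "h w \<noteq> -\<infinity>" for w
    using g h by (auto simp: Gamma0_def)
  have g_epi: "closed {(x, r :: real). g x \<le> ereal r}" and h_epi: "closed {(x, r :: real). h x \<le> ereal r}"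
    using g h by (auto simp: Gamma0_def)
  obtain M where M: "\<And>w. w \<in> C \<Longrightarrow> ereal M \<le> f w"
    using bdd_below by blast
  \<comment> \<open>If \<open>h w\<close> were infinite at finite \<open>g w\<close>, then
    \<open>f w\<close> would be -\<infinity>, against the lower bound; if \<open>g w\<close> were
    infinite, \<open>f w\<close> would be \<infinity> by the convention on differences.\<close>
  have finite_dom: "\<bar>g w\<bar> \<noteq> \<infinity>" "\<bar>h w\<bar> \<noteq> \<infinity>" if "w \<in> C" "f w \<noteq> \<infinity>" for w
    using M[OF that(1)] that(2) g_proper[of w] h_proper[of w]
    by (cases "g w"; cases "h w"; auto simp: f)+
  have dom: "\<bar>h w\<bar> \<noteq> \<infinity>" if "w \<in> C" "g w \<noteq> \<infinity>" for w
    using M[OF that(1)] that(2) g_proper[of w] h_proper[of w]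
    by (cases "g w"; cases "h w") (auto simp: f)

  have "\<exists>w\<in>C. g w \<noteq> \<infinity>"
  proof (rule ccontr)
    assume "\<not> (\<exists>w\<in>C. g w \<noteq> \<infinity>)"
    then have "(g w + chi C w) - h w = \<infinity>" for w
      by (cases "w \<in> C") (auto simp: chi_def)
    then show False using finite_value by simp
  qed
  then obtain w0 where w0: "w0 \<in> C" "g w0 \<noteq> \<infinity>" by blast

  define \<psi> where "\<psi> = (\<lambda>w. g w + chi C w)"
  have \<psi>_proper: "\<psi> w \<noteq> -\<infinity>" for w
    using g_proper[of w] by (auto simp: \<psi>_def chi_def)
  have \<Phi>_eq: "\<Phi> = (\<lambda>w. \<psi> w - h w)"
    by (auto simp: \<Phi> f \<psi>_def chi_def)
  have "closed C"
    unfolding C using u v by (rule closed_convex_constraints)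
  then have \<psi>_epi: "closed {(x, r :: real). \<psi> x \<le> ereal r}"
    unfolding \<psi>_def epigraph_add_chi using g_epi by (intro closed_Int closed_Times) auto

  have z_h: "z k \<in> subdiff h (x k)"
    and z_min: "is_arg_min (\<lambda>w. g w - ereal (w \<bullet> z k)) (\<lambda>w. w \<in> C) (y k)" for k
    using dca by (auto simp: boosted_dca_def Let_def)
  have y_C: "y k \<in> C" and z_\<psi>: "z k \<in> subdiff \<psi> (y k)" for k
    using arg_min_on_imp_subdiff[of g, OF g_proper w0 z_min] by (auto simp: \<psi>_def)
  have gy: "\<bar>g (y k)\<bar> \<noteq> \<infinity>" for k
    using z_\<psi>[of k] y_C[of k] by (auto simp: subdiff_def \<psi>_def chi_def)
  have hy: "\<bar>h (y k)\<bar> \<noteq> \<infinity>" for k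
    using dom[OF y_C[of k]] gy[of k] by auto
  define F where "F w = real_of_ereal (f w)" for w
  have fy_fin: "\<bar>f (y k)\<bar> \<noteq> \<infinity>" for k
    using gy[of k] hy[of k] by (cases "g (y k)"; cases "h (y k)") (auto simp: f)
  then have fy: "f (y k) = ereal (F (y k))" for k
    by (simp add: F_def ereal_real)
  \<comment> \<open>The starting point may lie outside \<open>C\<close>, so feasibility, finiteness
    and decrease at \<open>x\<close> are stated from index 1 on.\<close>
  have x_C: "x (Suc k) \<in> C" and f_step: "f (x (Suc k)) \<le> f (y k)"
    and x_step: "norm (x (Suc k) - x k) \<le> (1 + \<alpha>0) * norm (y k - x k)" for k
    using boosted_dca_step[OF dca, of k] params y_C[of k] fy_fin[of k] by (auto simp: f)
  have fx_fin: "\<bar>f (x (Suc k))\<bar> \<noteq> \<infinity>" for k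
    using f_step[of k] fy_fin[of k] M[OF x_C[of k]] by (auto simp: fy)
  then have fx: "f (x (Suc k)) = ereal (F (x (Suc k)))" for k
    by (simp add: F_def ereal_real)
  have gx: "\<bar>g (x (Suc k))\<bar> \<noteq> \<infinity>" and hx: "\<bar>h (x (Suc k))\<bar> \<noteq> \<infinity>" for k
    using finite_dom[OF x_C[of k]] fx_fin[of k] by auto
  have F_eq: "F w = real_of_ereal (g w) - real_of_ereal (h w)"
    if "\<bar>g w\<bar> \<noteq> \<infinity>" "\<bar>h w\<bar> \<noteq> \<infinity>" for w
    using that by (cases "g w"; cases "h w") (auto simp: F_def f)

  \<comment> \<open>Sufficient decrease and convergence of the values\<close>
  define c where "c = (\<rho>g + \<rho>h) / 2"
  have c: "c > 0" using strongly by (simp add: c_def)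
  define D where "D k = norm (y k - x k)" for k
  \<comment> \<open>The growth of \<open>g\<close> is taken at \<open>y\<close> towards
    \<open>x\<close> and that of \<open>h\<close> at \<open>x\<close> towards \<open>y\<close>, with
    the same \<open>z\<close>; in the sum the two inner products cancel.\<close>
  have decrease: "c * (D (Suc k))\<^sup>2 \<le> F (x (Suc k)) - F (y (Suc k))" for k
  proof -
    let ?x = "x (Suc k)" and ?y = "y (Suc k)" and ?z = "z (Suc k)"
    have "real_of_ereal (g ?y) + ?z \<bullet> (?x - ?y) + \<rho>g / 2 * (norm (?x - ?y))\<^sup>2 \<le> real_of_ereal (g ?x)"
    proof (rule modulus_growth[OF \<rho>g(2) y_C x_C])
      show "g ?y + ereal (?z \<bullet> (w - ?y)) \<le> g w" if "w \<in> C" for w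
        using z_\<psi>[of "Suc k"] that y_C[of "Suc k"] by (auto simp: subdiff_def \<psi>_def chi_def dest: spec[of _ w])
    qed (use gx[of k] gy[of "Suc k"] in \<open>simp_all add: ereal_real\<close>)
    moreover have "real_of_ereal (h ?x) + ?z \<bullet> (?y - ?x) + \<rho>h / 2 * (norm (?y - ?x))\<^sup>2 \<le> real_of_ereal (h ?y)"
    proof (rule modulus_growth[OF \<rho>h(2) x_C y_C])
      show "h ?x + ereal (?z \<bullet> (w - ?x)) \<le> h w" for w
        using z_h[of "Suc k"] by (auto simp: subdiff_def)
    qed (use hx[of k] hy[of "Suc k"] in \<open>simp_all add: ereal_real\<close>)
    ultimately show ?thesis
      by (simp add: F_eq gx hx gy hy c_def D_def norm_minus_commute inner_diff_right add_divide_distrib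
          distrib_right)
  qed
  have F_step: "F (x (Suc k)) \<le> F (y k)" for k
    using f_step[of k] by (simp add: fx fy)
  have F_yx: "F (y (Suc k)) \<le> F (x (Suc k))" for k
    using decrease[of k] c by (smt (verit) mult_nonneg_nonneg zero_le_power2)

  have i: "\<forall>k\<ge>1. f (x k) - f (y k) \<ge> ereal ((\<rho>g + \<rho>h) / 2 * (norm (x k - y k))\<^sup>2)"
  proof (intro allI impI)
    fix k :: nat assume "k \<ge> 1"
    then obtain m where "k = Suc m" by (cases k) auto
    then show "f (x k) - f (y k) \<ge> ereal ((\<rho>g + \<rho>h) / 2 * (norm (x k - y k))\<^sup>2)"
      using decrease[of m] by (simp add: fx fy c_def D_def norm_minus_commute)
  qed

  have mono: "F (x (Suc (Suc k))) \<le> F (x (Suc k))" for k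
    using F_step[of "Suc k"] F_yx[of k] by simp
  have lower: "M \<le> F (x (Suc k))" for k
    using M[OF x_C[of k]] by (simp add: fx)
  obtain l where l: "(\<lambda>k. F (x (Suc k))) \<longlonglongrightarrow> l"
    using decseq_convergent[of "\<lambda>k. F (x (Suc k))" M] mono lower decseq_SucI by metis
  then have fl: "(\<lambda>k. f (x k)) \<longlonglongrightarrow> ereal l"
    by (auto intro: LIMSEQ_imp_Suc[of "\<lambda>k. f (x k)"] simp: fx)
  have ii: "\<forall>k\<ge>1. \<bar>f (x k)\<bar> \<noteq> \<infinity> \<and> f (x (Suc k)) \<le> f (x k)"
  proof (intro allI impI)
    fix k :: nat assume "k \<ge> 1"
    then obtain m where "k = Suc m" by (cases k) auto
    then show "\<bar>f (x k)\<bar> \<noteq> \<infinity> \<and> f (x (Suc k)) \<le> f (x k)"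
      using mono[of m] by (simp add: fx)
  qed

  \<comment> \<open>Square summability by telescoping\<close>
  have "summable (\<lambda>k. F (x (Suc k)) - F (x (Suc (Suc k))))"
    using telescope_summable'[OF l] .
  then have "summable (\<lambda>k. (F (x (Suc k)) - F (x (Suc (Suc k)))) / c)"
    by (rule summable_divide)
  then have "summable (\<lambda>k. (D (Suc k))\<^sup>2)"
  proof (rule summable_comparison_test'[where N = 0])
    fix k
    show "norm ((D (Suc k))\<^sup>2) \<le> (F (x (Suc k)) - F (x (Suc (Suc k)))) / c"
      using decrease[of k] F_step[of "Suc k"] c by (simp add: field_simps)
  qed
  then have D2: "summable (\<lambda>k. (D k)\<^sup>2)"
    by (subst (asm) summable_Suc_iff)
  have X2: "summable (\<lambda>k. (norm (x (Suc k) - x k))\<^sup>2)"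
  proof (rule summable_comparison_test'[where N = 0])
    show "summable (\<lambda>k. (1 + \<alpha>0)\<^sup>2 * (D k)\<^sup>2)" using D2 by (rule summable_mult)
    show "norm ((norm (x (Suc k) - x k))\<^sup>2) \<le> (1 + \<alpha>0)\<^sup>2 * (D k)\<^sup>2" for k
    proof -
      have "(norm (x (Suc k) - x k))\<^sup>2 \<le> ((1 + \<alpha>0) * D k)\<^sup>2"
        using x_step[of k] unfolding D_def by (intro power_mono norm_ge_zero)
      then show ?thesis unfolding power_mult_distrib by simp
    qed
  qed
  have D0: "D \<longlonglongrightarrow> 0"
    using summable_LIMSEQ_zero[OF D2] by (simp add: power_tendsto_0_iff)
  have X0: "(\<lambda>k. norm (x (Suc k) - x k)) \<longlonglongrightarrow> 0"
    using summable_LIMSEQ_zero[OF X2] by (simp add: power_tendsto_0_iff)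

  \<comment> \<open>Limit points are critical\<close>
  \<comment> \<open>A further subsequence makes the bounded \<open>z\<close> converge, and
    \<open>y\<close> follows \<open>x\<close> since their difference tends to 0. The convergence of
    the \<open>\<psi>\<close> values is recorded to identify the limit value later.\<close>
  have limit: "\<exists>s \<zeta>. strict_mono s \<and> (y \<circ> s) \<longlonglongrightarrow> a \<and> \<zeta> \<in> subdiff h a \<and> \<zeta> \<in> subdiff \<psi> a \<and>
      (\<lambda>j. \<psi> (y (s j))) \<longlonglongrightarrow> \<psi> a" if lp: "seq_limit_point x a" for a
  proof -
    obtain r where r: "strict_mono r" "(x \<circ> r) \<longlonglongrightarrow> a"
      using lp by (auto simp: seq_limit_point_def)
    have "bounded ((\<lambda>(a, b, c). c) ` range (\<lambda>k. (x k, y k, z k)))"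
      using bounded_snd[OF bounded_snd[OF bdd]] by (simp add: image_image case_prod_unfold)
    then have "bounded (range (z \<circ> r))"
      by (rule bounded_subset) (auto simp: image_image)
    then obtain \<zeta> r' where r': "strict_mono r'" "((z \<circ> r) \<circ> r') \<longlonglongrightarrow> \<zeta>"
      using bounded_imp_convergent_subsequence by blast
    define s where "s = r \<circ> r'"
    have s: "strict_mono s" using r r' by (simp add: s_def strict_mono_o)
    have zs: "(\<lambda>j. z (s j)) \<longlonglongrightarrow> \<zeta>" using r' by (simp add: s_def comp_def)
    have xs: "(\<lambda>j. x (s j)) \<longlonglongrightarrow> a"
      using LIMSEQ_subseq_LIMSEQ[OF r(2) r'(1)] by (simp add: s_def comp_def)
    have "(\<lambda>k. y k - x k) \<longlonglongrightarrow> 0"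
      using D0 unfolding D_def by (rule tendsto_norm_zero_cancel)
    from LIMSEQ_subseq_LIMSEQ[OF this s] have "(\<lambda>j. y (s j) - x (s j)) \<longlonglongrightarrow> 0"
      by (simp add: comp_def)
    from tendsto_add[OF this xs] have ys: "(\<lambda>j. y (s j)) \<longlonglongrightarrow> a" by simp
    show ?thesis
      using s ys subdiff_closed_graph[OF h_epi h_proper xs zs z_h]
        subdiff_closed_graph[OF \<psi>_epi \<psi>_proper ys zs z_\<psi>]
      by (intro exI[of _ s] exI[of _ \<zeta>]) (simp add: comp_def)
  qed
  have critical: "dc_critical C g h a" if "seq_limit_point x a" for a
    using limit[OF that] unfolding dc_critical_def \<psi>_def by blast
  have limit_dom: "a \<in> C \<and> \<bar>g a\<bar> \<noteq> \<infinity>" if "seq_limit_point x a" for a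
    using limit[OF that] by (auto simp: subdiff_def \<psi>_def chi_def split: if_splits)
  have strong: "strongly_dc_critical C g h a"
    if diff: "cont_diff_around (C \<inter> eff_domain g) h" and lp: "seq_limit_point x a" for a
  proof -
    have "a \<in> C \<inter> eff_domain g"
      using limit_dom[OF lp] by (auto simp: eff_domain_def)
    then obtain w where "has_gradient h w a"
      using diff unfolding cont_diff_around_def by blast
    then show ?thesis using critical[OF lp] dc_critical_imp_strongly by blast
  qed

  \<comment> \<open>Finite length and convergence of the whole sequence\<close>
  have vi: "(summable (\<lambda>k. norm (y k - x k)) \<and> summable (\<lambda>k. norm (x (Suc k) - x k))) \<and>
       (\<exists>xs. x \<longlonglongrightarrow> xs \<and> strongly_dc_critical C g h xs)"
    if loj: "lojasiewicz \<Phi>" and lip: "loc_lipschitz_gradient_on C h"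
  proof -
    obtain G where G: "\<And>w. w \<in> C \<Longrightarrow> has_gradient h (G w) w"
      and G_lip: "\<And>w. w \<in> C \<Longrightarrow> \<exists>r>0. \<exists>L. lipschitz_on L (ball w r \<inter> C) G"
      using lip unfolding loc_lipschitz_gradient_on_def by blast
    have "bounded (range (\<lambda>k. x (Suc k)))"
      using bounded_fst[OF bdd] by (rule bounded_subset) (auto simp: image_image)
    then obtain a r where r: "strict_mono r" "((\<lambda>k. x (Suc k)) \<circ> r) \<longlonglongrightarrow> a"
      using bounded_imp_convergent_subsequence by blast
    then have lp: "seq_limit_point x a"
      unfolding seq_limit_point_def
      by (intro exI[of _ "Suc \<circ> r"]) (auto simp: comp_def strict_mono_def)
    have a: "a \<in> C" "\<bar>g a\<bar> \<noteq> \<infinity>" "\<bar>h a\<bar> \<noteq> \<infinity>"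
      using limit_dom[OF lp] dom[of a] by auto
    obtain s \<zeta> where s: "strict_mono s" "(y \<circ> s) \<longlonglongrightarrow> a" "\<zeta> \<in> subdiff h a" "\<zeta> \<in> subdiff \<psi> a"
      "(\<lambda>j. \<psi> (y (s j))) \<longlonglongrightarrow> \<psi> a"
      using limit[OF lp] by blast

    have sub_\<Phi>: "\<xi> - G w \<in> limiting_subdiff \<Phi> w" if "w \<in> C" "\<xi> \<in> subdiff \<psi> w" for w \<xi>
      using frechet_subdiff_diff[of \<psi>, OF \<psi>_proper that(2) G[OF that(1)]]
        frechet_subset_limiting_subdiff unfolding \<Phi>_eq by blast
    \<comment> \<open>The common subgradient \<open>\<zeta>\<close> equals \<open>G a\<close>, so
      \<open>\<zeta> - G a = 0\<close> is a limiting subgradient and the Lojasiewicz inequality is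
      available around \<open>a\<close>.\<close>
    have "0 \<in> limiting_subdiff \<Phi> a"
      using sub_\<Phi>[OF a(1) s(4)] subdiff_unique_gradient[OF G[OF a(1)] s(3)] by simp
    then have "\<exists>\<theta> L V. 0 \<le> \<theta> \<and> \<theta> < 1 \<and> L > 0 \<and> open V \<and> a \<in> V \<and>
        (\<forall>w\<in>V. \<forall>\<xi>\<in>limiting_subdiff \<Phi> w. epowr \<bar>\<Phi> w - \<Phi> a\<bar> \<theta> \<le> ereal (L * norm \<xi>))"
      using loj unfolding lojasiewicz_def by (elim allE[of _ a] impE)
    then obtain \<theta> L V where "0 \<le> \<theta> \<and> \<theta> < 1 \<and> L > 0 \<and> open V \<and> a \<in> V \<and>
        (\<forall>w\<in>V. \<forall>\<xi>\<in>limiting_subdiff \<Phi> w. epowr \<bar>\<Phi> w - \<Phi> a\<bar> \<theta> \<le> ereal (L * norm \<xi>))"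
      by (elim exE)
    then have \<theta>: "0 \<le> \<theta>" "\<theta> < 1" and L: "L > 0" and V: "open V" "a \<in> V"
      and KL: "\<And>w \<xi>. w \<in> V \<Longrightarrow> \<xi> \<in> limiting_subdiff \<Phi> w \<Longrightarrow> epowr \<bar>\<Phi> w - \<Phi> a\<bar> \<theta> \<le> ereal (L * norm \<xi>)"
      by simp_all
    obtain e1 where e1: "e1 > 0" "ball a e1 \<subseteq> V"
      using V openE by blast
    obtain e2 K where e2: "e2 > 0" and K: "lipschitz_on K (ball a e2 \<inter> C) G"
      using G_lip[OF a(1)] by blast

    have Fa: "f a = ereal (F a)"
      using a by (cases "g a"; cases "h a") (auto simp: f F_def)
    \<comment> \<open>No continuity of \<open>g\<close> is at hand: its values converge along
      \<open>y \<circ> s\<close> by the closed graph lemma, while \<open>h\<close> is continuous at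
      \<open>a\<close> because it is differentiable there. The values at \<open>y\<close> tend to
      \<open>l\<close>, being squeezed between consecutive values at \<open>x\<close>.\<close>
    have "l = F a"
    proof -
      have "(\<lambda>j. real_of_ereal (\<psi> (y (s j)))) \<longlonglongrightarrow> real_of_ereal (\<psi> a)"
        using s(5) a by (intro lim_real_of_ereal) (auto simp: \<psi>_def chi_def ereal_real)
      then have "(\<lambda>j. real_of_ereal (g (y (s j)))) \<longlonglongrightarrow> real_of_ereal (g a)"
        using y_C a by (simp add: \<psi>_def chi_def)
      moreover have "isCont (\<lambda>w. real_of_ereal (h w)) a"
        using G[OF a(1)] unfolding has_gradient_def gderiv_def by (blast dest: has_derivative_continuous)
      then have "(\<lambda>j. real_of_ereal (h (y (s j)))) \<longlonglongrightarrow> real_of_ereal (h a)"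
        using s(2) isCont_tendsto_compose by (fastforce simp: comp_def)
      ultimately have "(\<lambda>j. F (y (s j))) \<longlonglongrightarrow> F a"
        using gy hy a by (simp add: F_eq tendsto_diff)
      moreover have "(\<lambda>k. F (y (Suc k))) \<longlonglongrightarrow> l"
      proof (rule tendsto_sandwich)
        show "(\<lambda>k. F (x (Suc (Suc k)))) \<longlonglongrightarrow> l" "(\<lambda>k. F (x (Suc k))) \<longlonglongrightarrow> l"
          using LIMSEQ_Suc[OF l] l .
      qed (use F_step F_yx in auto)
      then have "(\<lambda>k. F (y k)) \<longlonglongrightarrow> l" by (rule LIMSEQ_imp_Suc)
      from LIMSEQ_subseq_LIMSEQ[OF this s(1)] have "(\<lambda>j. F (y (s j))) \<longlonglongrightarrow> l"
        by (simp add: comp_def)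
      ultimately show ?thesis using LIMSEQ_unique by blast
    qed
    have F_ge: "F a \<le> F (x (Suc k))" for k
      using decseq_ge[OF decseq_SucI[of "\<lambda>k. F (x (Suc k))", OF mono] l, of k] \<open>l = F a\<close> by simp

    \<comment> \<open>The gap is measured at \<open>y\<close>; descent from \<open>t k\<close> to
      \<open>t (Suc k)\<close> passes through \<open>x (Suc (Suc k))\<close>, whose value is at most
      that at \<open>y (Suc k)\<close>.\<close>
    define t where "t k = F (y (Suc k)) - F a" for k
    have t_nonneg: "0 \<le> t k" for k
      using F_step[of "Suc k"] F_ge[of "Suc k"] by (simp add: t_def)
    have "(\<lambda>k. F (x (Suc k)) - F a) \<longlonglongrightarrow> 0"
      using tendsto_diff[OF l tendsto_const[of "F a"]] \<open>l = F a\<close> by simp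
    then have t0: "t \<longlonglongrightarrow> 0"
      by (rule tendsto_sandwich[OF _ _ tendsto_const, rotated 2])
        (use t_nonneg F_yx in \<open>auto simp: t_def\<close>)

    have "summable (\<lambda>k. D (Suc k))"
    \<comment> \<open>The sequences are shifted past the possibly infeasible \<open>x 0\<close>.
      \<open>K + 1\<close> keeps the constant positive even if \<open>K = 0\<close>, and the smaller
      radius gives both the Lojasiewicz inequality and the Lipschitz bound.\<close>
    proof (rule KL_finite_length[where X = "\<lambda>k. x (Suc k)" and Y = "\<lambda>k. y (Suc k)" and t = t
          and D = "\<lambda>k. D (Suc k)" and c = c and \<theta> = \<theta> and M = "L * (K + 1)" and B = "1 + \<alpha>0" and e = "min e1 e2" and r = r and a = a])
      have K0: "K \<ge> 0" using K by (rule lipschitz_on_nonneg)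
      show "L * (K + 1) > 0" using L K0 by simp
      show "c * (D (Suc (Suc k)))\<^sup>2 \<le> t k - t (Suc k)" for k
        using decrease[of "Suc k"] F_step[of "Suc k"] by (simp add: t_def)
      show "t k powr \<theta> \<le> L * (K + 1) * D (Suc k)"
        if "x (Suc k) \<in> ball a (min e1 e2)" "y (Suc k) \<in> ball a (min e1 e2)" "t k > 0" for k
      proof -
        let ?x = "x (Suc k)" and ?y = "y (Suc k)"
        have "z (Suc k) = G ?x"
          using subdiff_unique_gradient[OF G[OF x_C] z_h] .
        then have "epowr \<bar>\<Phi> ?y - \<Phi> a\<bar> \<theta> \<le> ereal (L * norm (G ?x - G ?y))"
          using KL[of ?y] sub_\<Phi>[OF y_C z_\<psi>, of "Suc k"] that(2) e1(2) by auto
        moreover have "\<bar>\<Phi> ?y - \<Phi> a\<bar> = ereal (t k)"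
          using y_C a(1) that(3) by (simp add: \<Phi> chi_def fy Fa t_def)
        moreover have "epowr (ereal (t k)) \<theta> = ereal (t k powr \<theta>)"
          using that(3) by (simp add: epowr_def one_ereal_def)
        ultimately have "t k powr \<theta> \<le> L * norm (G ?x - G ?y)" by simp
        also have "norm (G ?x - G ?y) \<le> K * norm (?x - ?y)"
          using lipschitz_onD[OF K, of ?x ?y] that x_C y_C by (simp add: dist_norm)
        also have "K * norm (?x - ?y) \<le> (K + 1) * D (Suc k)"
          by (simp add: D_def norm_minus_commute distrib_right)
        finally show ?thesis using L by (simp add: mult.assoc)
      qed
    qed (use \<theta> c params e1 e2 x_step t_nonneg t0 LIMSEQ_Suc[OF D0] r in \<open>auto simp: D_def\<close>)
    then have D1: "summable D" by (subst (asm) summable_Suc_iff)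
    have X1: "summable (\<lambda>k. norm (x (Suc k) - x k))"
    proof (rule summable_comparison_test'[where N = 0])
      show "summable (\<lambda>k. (1 + \<alpha>0) * D k)" using D1 by (rule summable_mult)
      show "norm (norm (x (Suc k) - x k)) \<le> (1 + \<alpha>0) * D k" for k
        using x_step[of k] by (simp add: D_def)
    qed
    \<comment> \<open>By completeness absolute summability gives summability of the increments,
      whose partial sums telescope to \<open>x n - x 0\<close>.\<close>
    then have "summable (\<lambda>k. x (Suc k) - x k)" by (rule summable_norm_cancel)
    then have "(\<lambda>n. \<Sum>k<n. x (Suc k) - x k) \<longlonglongrightarrow> (\<Sum>k. x (Suc k) - x k)"
      by (rule summable_LIMSEQ)
    then have "(\<lambda>n. x n - x 0) \<longlonglongrightarrow> (\<Sum>k. x (Suc k) - x k)"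
      by (simp add: sum_lessThan_telescope)
    from tendsto_add[OF this tendsto_const[of "x 0"]]
    obtain b where b: "x \<longlonglongrightarrow> b" by auto
    then have lpb: "seq_limit_point x b"
      unfolding seq_limit_point_def by (intro exI[of _ id]) (auto simp: strict_mono_def)
    have "strongly_dc_critical C g h b"
      using dc_critical_imp_strongly[OF critical[OF lpb] G] limit_dom[OF lpb] by blast
    then show ?thesis
      using D1 X1 b unfolding D_def by blast
  qed

  have "(\<lambda>k. norm (x k - y k)) \<longlonglongrightarrow> 0" "(\<lambda>k. norm (x k - x (Suc k))) \<longlonglongrightarrow> 0"
    using D0 X0 unfolding D_def by (simp_all add: norm_minus_commute)
  then show ?thesis
    using i ii fl D2 X2 critical strong vi unfolding D_def by blast
qed

end
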